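(* Let $p$ be a prime. The image of the transform map $\mathscr{I}: C(\mathbb{Z}_p,\mathbb{C}_p)\to\mathrm{la}(\mathbb{Z}_p,\mathbb{C}_p)$ consists of the functions $$\Psi = \sum_{n=0}^\infty a_n\frac{(-1)^n}{n!}\nabla^nq$$ where $(a_n)_{n\ge0}$ is a sequence in $\mathbb{C}_p$ converging to zero. A function $\Psi$ in the image determines the coefficients $a_n$ in this expression uniquely.
   Context: $C(\mathbb{Z}_p,\mathbb{C}_p)$ is the $\mathbb{C}_p$-vector space of continuous functions $\mathbb{Z}_p \to \mathbb{C}_p$, and $\mathrm{la}(\mathbb{Z}_p,\mathbb{C}_p)$ is the subspace of locally analytic functions (those given, near each $x_0\in\mathbb{Z}_p$, by a convergent power series in $x-x_0$ with coefficients in $\mathbb{C}_p$). For $\psi\in C(\mathbb{Z}_p,\mathbb{C}_p)$, $\mathscr{I}(\psi)$ is the locally analytic function $\mathscr{I}(\psi)(s) = \sum_{n=0}^\infty n!\,\psi(-1-n)\binom{s}{n}$. The operator $\nabla$ is the forward difference, $(\nabla\phi)(x) = \phi(x+1)-\phi(x)$. The function $q:\mathbb{Z}_p\to\mathbb{C}_p$ is $q(x) = \sum_{n=0}^\infty n!\binom{x}{n}$ (equivalently the unique continuous function satisfying $q(x) - xq(x-1) = 1$ for all $x\in\mathbb{Z}_p$). The functions $\frac{1}{n!}\nabla^nq$ map $\mathbb{Z}_p$ into $\mathbb{Z}_p$, so the series converges uniformly when $a_n\to0$. *)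

theory Defs
  imports
    "HOL-Analysis.Analysis"
    "HOL-Computational_Algebra.Primes"
    "HOL-Computational_Algebra.Polynomial"
begin

text \<open>
  The field of $p$-adic complex numbers is not in the library. It is described here up to
  isometric isomorphism, as a completion of an algebraic closure of the $p$-adic numbers.
  The absolute value induces the metric, so continuity, limits, infinite sums and completeness are
  those of the library. (The library's \<open>norm\<close> is reserved for real vector spaces.)
\<close>

class nonarch_valued_field = field_char_0 + metric_space +
  fixes vabs :: "'a \<Rightarrow> real"
  assumes dist_vabs: "dist x y = vabs (x - y)"
    and vabs_mult: "vabs (x * y) = vabs x * vabs y"
    and vabs_add: "vabs (x + y) \<le> max (vabs x) (vabs y)"

text \<open>
  In a complete field whose absolute value is $p$-adic on the rationals, the closure of the
  rationals is the completion of the rationals, that is, the field of $p$-adic numbers.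
\<close>

definition Qp :: "'a::nonarch_valued_field set" where
  "Qp = closure \<rat>"

definition Zp :: "'a::nonarch_valued_field set" where
  "Zp = {x \<in> Qp. vabs x \<le> 1}"

definition Qp_alg_closure :: "'a::nonarch_valued_field set" where
  "Qp_alg_closure = {x. \<exists>f. f \<noteq> 0 \<and> (\<forall>i. coeff f i \<in> Qp) \<and> poly f x = 0}"

text \<open>
  Completeness is part of the sort. The first condition says that the absolute value restricts to
  the $p$-adic one on the integers, hence, by multiplicativity, on the rationals.
\<close>

definition is_Cp :: "nat \<Rightarrow> 'a::{nonarch_valued_field, complete_space} itself \<Rightarrow> bool" where
  "is_Cp p T \<longleftrightarrow>
     (\<forall>k::int. k \<noteq> 0 \<longrightarrow> vabs (of_int k :: 'a) = (1 / real p) ^ multiplicity (int p) k) \<and>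
     (\<forall>f::'a poly. degree f > 0 \<and> (\<forall>i. coeff f i \<in> Qp_alg_closure)
        \<longrightarrow> (\<exists>x\<in>Qp_alg_closure. poly f x = 0)) \<and>
     closure (Qp_alg_closure :: 'a set) = UNIV"

text \<open>
  A function on \<^const>\<open>Zp\<close> is represented by its unique extension that is \<^const>\<open>undefined\<close>
  outside \<^const>\<open>Zp\<close>, so that equality of functions is equality on \<^const>\<open>Zp\<close>.
\<close>

definition continuous_Zp :: "('a::nonarch_valued_field \<Rightarrow> 'a) set" where
  "continuous_Zp = {f \<in> extensional Zp. continuous_on Zp f}"

definition locally_analytic_Zp :: "('a::nonarch_valued_field \<Rightarrow> 'a) set" where
  "locally_analytic_Zp = {f \<in> extensional Zp.
     \<forall>x0\<in>Zp. \<exists>r>0. \<exists>c. \<forall>x\<in>Zp. dist x x0 < r \<longrightarrow> (\<lambda>n. c n * (x - x0) ^ n) sums f x}"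

definition transform ::
  "('a::nonarch_valued_field \<Rightarrow> 'a) \<Rightarrow> 'a \<Rightarrow> 'a" where
  "transform \<psi> = (\<lambda>s\<in>Zp. \<Sum>n. fact n * \<psi> (- 1 - of_nat n) * (s gchoose n))"

definition nabla :: "('a::nonarch_valued_field \<Rightarrow> 'a) \<Rightarrow> 'a \<Rightarrow> 'a" where
  "nabla \<phi> = (\<lambda>x\<in>Zp. \<phi> (x + 1) - \<phi> x)"

definition q :: "'a::nonarch_valued_field \<Rightarrow> 'a" where
  "q = (\<lambda>x\<in>Zp. \<Sum>n. fact n * (x gchoose n))"

definition q_term :: "(nat \<Rightarrow> 'a::nonarch_valued_field) \<Rightarrow> nat \<Rightarrow> 'a \<Rightarrow> 'a" where
  "q_term a n s = a n * ((- 1) ^ n / fact n) * (nabla ^^ n) q s"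

definition q_series :: "(nat \<Rightarrow> 'a::nonarch_valued_field) \<Rightarrow> 'a \<Rightarrow> 'a" where
  "q_series a = (\<lambda>s\<in>Zp. \<Sum>n. q_term a n s)"

end

theory Submission imports Defs
begin

text \<open>
  The transform turns Mahler expansions into the series of the theorem. Its value on the binomial
  function \<open>x \<mapsto> binomial(x, k)\<close> is
  \<open>(\<Sum>n. n! * binomial(- 1 - n, k) * binomial(s, n))\<close>. Since
  \<open>binomial(- 1 - n, k) = (- 1) ^ k * binomial(n + k, k)\<close> and
  \<open>n! * binomial(n + k, k) = (n + k)! / k!\<close>, this is \<open>(- 1) ^ k / k!\<close> times
  \<open>(\<Sum>n. (n + k)! * binomial(s, n))\<close>, and the last series is the \<open>k\<close>-th difference of \<open>q\<close>,
  because the difference operator shifts Mahler coefficients. Interchanging two sums extends the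
  computation to all Mahler series with coefficients tending to zero (\<open>transform_mahler\<close>).

  By Mahler's theorem (\<open>mahler_expansion\<close>) these are all the continuous functions on \<open>Zp\<close>, which gives the
  image. Its proof rests on the fact that \<open>p\<close> divides the inner binomial coefficients
  of order \<open>p ^ t\<close>, so that taking differences of order \<open>p ^ t\<close> repeatedly contracts a uniformly
  continuous function down to its oscillation under the shift by \<open>p ^ t\<close>.

  The coefficients are unique because both steps are injective. The values of a Mahler series at the
  natural numbers determine its coefficients by a triangular system; in the same way the transform
  determines the values of \<open>\<psi>\<close> at the points \<open>- 1 - n\<close>, which are dense in \<open>Zp\<close>
  (\<open>inj_on_mahler\<close>, \<open>inj_on_transform\<close>).

  Local analyticity comes from the size of \<open>n! * binomial(x0 + h, n) = (\<Prod>k<n. x0 - k + h)\<close> as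
  a polynomial in \<open>h\<close>: on the disc of radius \<open>1 / p\<close> every \<open>p\<close>-th factor contributes \<open>1 / p\<close>
  (\<open>falling_poly_decay\<close>), so the series may be rearranged by powers of \<open>h\<close>.
\<close>

section \<open>Fields with an ultrametric absolute value\<close>

lemma vabs_eq_dist: "vabs (x::'a::nonarch_valued_field) = dist x 0"
  by (simp add: dist_vabs)

lemma vabs_nonneg [simp]: "0 \<le> vabs (x::'a::nonarch_valued_field)"
  by (simp add: vabs_eq_dist)

lemma vabs_eq_0_iff [simp]: "vabs (x::'a::nonarch_valued_field) = 0 \<longleftrightarrow> x = 0"
  by (simp add: vabs_eq_dist)

lemma vabs_zero [simp]: "vabs (0::'a::nonarch_valued_field) = 0"
  by simp

lemma vabs_one [simp]: "vabs (1::'a::nonarch_valued_field) = 1"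
  using vabs_mult[of "1::'a" 1] by simp

lemma vabs_minus [simp]: "vabs (- x::'a::nonarch_valued_field) = vabs x"
proof -
  have "vabs (- 1::'a) * vabs (- 1::'a) = 1"
    by (simp flip: vabs_mult)
  then have "vabs (- 1::'a) = 1"
    using vabs_nonneg[of "- 1::'a"] by (simp add: square_eq_1_iff)
  then show ?thesis
    using vabs_mult[of "- 1" x] by simp
qed

lemma vabs_minus_commute: "vabs (x - y::'a::nonarch_valued_field) = vabs (y - x)"
  by (metis vabs_minus minus_diff_eq)

lemma vabs_power: "vabs (x ^ n::'a::nonarch_valued_field) = vabs x ^ n"
  by (induction n) (auto simp: vabs_mult)

lemma vabs_divide: "vabs (x / y::'a::nonarch_valued_field) = vabs x / vabs y"
proof (cases "y = 0")
  case False
  then have "vabs (x / y) * vabs y = vabs x"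
    by (simp flip: vabs_mult)
  then show ?thesis using False by (simp add: field_simps)
qed auto

lemma vabs_add_le:
  fixes x y :: "'a::nonarch_valued_field"
  shows "vabs x \<le> B \<Longrightarrow> vabs y \<le> B \<Longrightarrow> vabs (x + y) \<le> B"
  using vabs_add[of x y] by auto

lemma vabs_diff_le:
  fixes x y :: "'a::nonarch_valued_field"
  shows "vabs x \<le> B \<Longrightarrow> vabs y \<le> B \<Longrightarrow> vabs (x - y) \<le> B"
  using vabs_add_le[of x B "- y"] by simp

lemma vabs_sum_le:
  fixes f :: "'b \<Rightarrow> 'a::nonarch_valued_field"
  assumes "\<And>i. i \<in> A \<Longrightarrow> vabs (f i) \<le> B" "0 \<le> B"
  shows "vabs (sum f A) \<le> B"
  using assms by (induction A rule: infinite_finite_induct) (auto intro: vabs_add_le)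

lemma vabs_mult_le_left:
  fixes x y :: "'a::nonarch_valued_field"
  assumes "vabs x \<le> 1"
  shows "vabs (x * y) \<le> vabs y"
  using mult_right_mono[OF assms, of "vabs y"] by (simp add: vabs_mult)

lemma tendsto_vabs_iff:
  fixes X :: "'b \<Rightarrow> 'a::nonarch_valued_field"
  shows "(X \<longlongrightarrow> L) F \<longleftrightarrow> ((\<lambda>n. vabs (X n - L)) \<longlongrightarrow> 0) F"
  by (simp add: tendsto_dist_iff[of X] dist_vabs)

lemma tendsto_0_vabs_iff:
  fixes X :: "'b \<Rightarrow> 'a::nonarch_valued_field"
  shows "(X \<longlongrightarrow> 0) F \<longleftrightarrow> ((\<lambda>n. vabs (X n)) \<longlongrightarrow> 0) F"
  by (simp add: tendsto_vabs_iff[of X])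

lemma tendsto_vabs_bound:
  fixes X :: "'b \<Rightarrow> 'a::nonarch_valued_field"
  assumes "eventually (\<lambda>n. vabs (X n - L) \<le> b n) F" "(b \<longlongrightarrow> 0) F"
  shows "(X \<longlongrightarrow> L) F"
  unfolding tendsto_vabs_iff[of X]
  by (rule tendsto_sandwich[OF _ assms(1) tendsto_const assms(2)]) auto

text \<open>
  The field operations are continuous for the metric of the absolute value. These two instances
  make the limit rules of the library for sums and products available.
\<close>

instance nonarch_valued_field \<subseteq> topological_ab_group_add
proof
  fix a b :: 'a
  let ?F = "nhds a \<times>\<^sub>F nhds b"
  have "((\<lambda>x. vabs (fst x - a)) \<longlongrightarrow> 0) ?F" "((\<lambda>x. vabs (snd x - b)) \<longlongrightarrow> 0) ?F"
    using tendsto_fst[OF filterlim_ident, of "(a,b)"] tendsto_snd[OF filterlim_ident, of "(a,b)"]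
    by (simp_all add: nhds_prod[symmetric] tendsto_vabs_iff)
  then have "((\<lambda>x. max (vabs (fst x - a)) (vabs (snd x - b))) \<longlongrightarrow> max 0 0) ?F"
    by (rule tendsto_max)
  moreover have "vabs (fst x + snd x - (a + b)) \<le> max (vabs (fst x - a)) (vabs (snd x - b))"
    for x :: "'a \<times> 'a"
    using vabs_add[of "fst x - a" "snd x - b"] by (simp add: algebra_simps)
  ultimately show "((\<lambda>x. fst x + snd x) \<longlongrightarrow> a + b) ?F"
    by (intro tendsto_vabs_bound[where b = "\<lambda>x. max (vabs (fst x - a)) (vabs (snd x - b))"]) auto
next
  fix a :: 'a
  have "((\<lambda>x. vabs (x - a)) \<longlongrightarrow> 0) (nhds a)"
    using filterlim_ident[of "nhds a"] by (simp add: tendsto_vabs_iff)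
  then show "(uminus \<longlongrightarrow> - a) (nhds a)"
    by (rule tendsto_vabs_bound[rotated]) (simp add: vabs_minus_commute)
qed

instance nonarch_valued_field \<subseteq> topological_comm_monoid_mult
proof
  fix a b :: 'a
  let ?F = "nhds a \<times>\<^sub>F nhds b"
  let ?u = "\<lambda>x::'a \<times> 'a. vabs (fst x - a)" and ?v = "\<lambda>x::'a \<times> 'a. vabs (snd x - b)"
  have "(?u \<longlongrightarrow> 0) ?F" "(?v \<longlongrightarrow> 0) ?F"
    using tendsto_fst[OF filterlim_ident, of "(a,b)"] tendsto_snd[OF filterlim_ident, of "(a,b)"]
    by (simp_all add: nhds_prod[symmetric] tendsto_vabs_iff)
  then have "((\<lambda>x. ?u x * ?v x + ?u x * vabs b + vabs a * ?v x) \<longlongrightarrow> 0 * 0 + 0 * vabs b + vabs a * 0) ?F"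
    by (intro tendsto_intros)
  moreover have "vabs (fst x * snd x - a * b) \<le> ?u x * ?v x + ?u x * vabs b + vabs a * ?v x" for x
  proof -
    have eq: "fst x * snd x - a * b = (fst x - a) * (snd x - b) + (fst x - a) * b + a * (snd x - b)"
      by (simp add: algebra_simps)
    show ?thesis
      unfolding eq by (intro vabs_add_le) (auto simp: vabs_mult)
  qed
  ultimately show "((\<lambda>x. fst x * snd x) \<longlongrightarrow> a * b) ?F"
    by (intro tendsto_vabs_bound[where b = "\<lambda>x. ?u x * ?v x + ?u x * vabs b + vabs a * ?v x"]) auto
qed

lemma vabs_limit_le:
  fixes X :: "nat \<Rightarrow> 'a::nonarch_valued_field"
  assumes "X \<longlonglongrightarrow> L" "eventually (\<lambda>n. vabs (X n) \<le> B) sequentially"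
  shows "vabs L \<le> B"
proof -
  have "closed (cball (0::'a) B)" by simp
  then have "L \<in> cball 0 B"
    by (rule Lim_in_closed_set[OF _ _ _ assms(1)])
      (use assms(2) in \<open>auto simp: vabs_eq_dist dist_commute\<close>)
  then show ?thesis by (simp add: vabs_eq_dist dist_commute)
qed

section \<open>Series over a complete ultrametric field\<close>

text \<open>
  The ultrametric inequality bounds a block of consecutive terms by its largest term, so the
  partial sums are Cauchy as soon as the terms tend to zero.
\<close>

lemma summable_ultrametric:
  fixes f :: "nat \<Rightarrow> 'a::{nonarch_valued_field, complete_space}"
  assumes "f \<longlonglongrightarrow> 0"
  shows "summable f"
proof -
  have "Cauchy (\<lambda>n. \<Sum>i<n. f i)"
  proof (rule metric_CauchyI)
    fix e :: real assume e: "0 < e"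
    then obtain N where N: "\<And>n. n \<ge> N \<Longrightarrow> vabs (f n) < e / 2"
      using assms by (metis LIMSEQ_def half_gt_zero vabs_eq_dist)
    have "dist (\<Sum>i<m. f i) (\<Sum>i<n. f i) < e" if "N \<le> n" "n \<le> m" for m n
    proof -
      have "(\<Sum>i<m. f i) - (\<Sum>i<n. f i) = (\<Sum>i\<in>{n..<m}. f i)"
        using that by (simp add: sum_diff_nat_ivl lessThan_atLeast0)
      moreover have "vabs (\<Sum>i\<in>{n..<m}. f i) \<le> e / 2"
        using that e by (intro vabs_sum_le less_imp_le[OF N]) auto
      ultimately show ?thesis using e by (simp add: dist_vabs)
    qed
    then show "\<exists>M. \<forall>m\<ge>M. \<forall>n\<ge>M. dist (\<Sum>i<m. f i) (\<Sum>i<n. f i) < e"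
      by (metis dist_commute nle_le)
  qed
  then show ?thesis
    by (simp add: summable_iff_convergent Cauchy_convergent)
qed

lemma suminf_tail_le:
  fixes f :: "nat \<Rightarrow> 'a::{nonarch_valued_field, complete_space}"
  assumes "f \<longlonglongrightarrow> 0" "\<And>n. n \<ge> N \<Longrightarrow> vabs (f n) \<le> B"
  shows "vabs (suminf f - (\<Sum>n<N. f n)) \<le> B"
proof (rule vabs_limit_le)
  show "(\<lambda>m. (\<Sum>n<m. f n) - (\<Sum>n<N. f n)) \<longlonglongrightarrow> suminf f - (\<Sum>n<N. f n)"
    by (intro tendsto_intros summable_LIMSEQ summable_ultrametric assms)
  have "0 \<le> B" using assms(2)[of N] vabs_nonneg order_trans by blast
  have "vabs ((\<Sum>n<m. f n) - (\<Sum>n<N. f n)) \<le> B" if "N \<le> m" for m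
  proof -
    have "(\<Sum>i<m. f i) - (\<Sum>i<N. f i) = (\<Sum>i\<in>{N..<m}. f i)"
      using that by (simp add: sum_diff_nat_ivl lessThan_atLeast0)
    then show ?thesis using assms(2) \<open>0 \<le> B\<close> by (auto intro: vabs_sum_le)
  qed
  then show "eventually (\<lambda>m. vabs ((\<Sum>n<m. f n) - (\<Sum>n<N. f n)) \<le> B) sequentially"
    by (auto simp: eventually_sequentially)
qed

lemma sums_mult_left:
  fixes f :: "nat \<Rightarrow> 'a::nonarch_valued_field"
  shows "f sums s \<Longrightarrow> (\<lambda>n. c * f n) sums (c * s)"
  unfolding sums_def by (simp add: tendsto_mult flip: sum_distrib_left)

lemma LIMSEQ_0_vabsI:
  fixes f :: "nat \<Rightarrow> 'a::nonarch_valued_field"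
  assumes "\<And>e. 0 < e \<Longrightarrow> \<exists>N. \<forall>n\<ge>N. vabs (f n) \<le> e"
  shows "f \<longlonglongrightarrow> 0"
proof (rule metric_LIMSEQ_I)
  fix e :: real assume e: "0 < e"
  then obtain N where "\<forall>n\<ge>N. vabs (f n) \<le> e / 2"
    using assms half_gt_zero by blast
  then have "\<forall>n\<ge>N. dist (f n) 0 < e"
    using e by (fastforce simp flip: vabs_eq_dist)
  then show "\<exists>N. \<forall>n\<ge>N. dist (f n) 0 < e" ..
qed

text \<open>
  If, for every \<open>e\<close>, all but finitely many entries of the array are at most \<open>e\<close>, then both iterated sums are the limit of
  the sums over the squares, because each row is approximated by its first \<open>N\<close> entries
  with an error that does not grow when \<open>N\<close> rows are added up. The description by squares
  is symmetric in the two indices, which is what makes the two iterated sums equal below.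
\<close>

lemma square_sums_tendsto:
  fixes F :: "nat \<Rightarrow> nat \<Rightarrow> 'a::{nonarch_valued_field, complete_space}"
  assumes F: "\<And>e. 0 < e \<Longrightarrow> \<exists>N. \<forall>i j. N \<le> i \<or> N \<le> j \<longrightarrow> vabs (F i j) \<le> e"
  shows "(\<lambda>i. suminf (F i)) \<longlonglongrightarrow> 0"
    and "(\<lambda>N. \<Sum>i<N. \<Sum>j<N. F i j) \<longlonglongrightarrow> (\<Sum>i. suminf (F i))"
proof -
  have row: "F i \<longlonglongrightarrow> 0" for i
    using F by (intro LIMSEQ_0_vabsI) blast
  show rows: "(\<lambda>i. suminf (F i)) \<longlonglongrightarrow> 0"
  proof (rule LIMSEQ_0_vabsI)
    fix e :: real assume "0 < e"
    then obtain N where "\<forall>i j. N \<le> i \<or> N \<le> j \<longrightarrow> vabs (F i j) \<le> e"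
      using F by blast
    then have "vabs (suminf (F i)) \<le> e" if "N \<le> i" for i
      using suminf_tail_le[OF row, of 0 i e] that by simp
    then show "\<exists>N. \<forall>i\<ge>N. vabs (suminf (F i)) \<le> e" by blast
  qed
  have "(\<lambda>N. (\<Sum>i<N. suminf (F i)) - (\<Sum>i<N. \<Sum>j<N. F i j)) \<longlonglongrightarrow> 0"
  proof (rule LIMSEQ_0_vabsI)
    fix e :: real assume e: "0 < e"
    then obtain N where N: "\<forall>i j. N \<le> i \<or> N \<le> j \<longrightarrow> vabs (F i j) \<le> e"
      using F by blast
    have "vabs ((\<Sum>i<n. suminf (F i)) - (\<Sum>i<n. \<Sum>j<n. F i j)) \<le> e" if "n \<ge> N" for n
      unfolding sum_subtractf[symmetric]
    proof (rule vabs_sum_le)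
      show "vabs (suminf (F i) - (\<Sum>j<n. F i j)) \<le> e" for i
        using N that by (intro suminf_tail_le[OF row]) auto
    qed (use e in simp)
    then show "\<exists>N. \<forall>n\<ge>N. vabs ((\<Sum>i<n. suminf (F i)) - (\<Sum>i<n. \<Sum>j<n. F i j)) \<le> e"
      by blast
  qed
  with summable_LIMSEQ[OF summable_ultrametric[OF rows]]
  have "(\<lambda>N. (\<Sum>i<N. suminf (F i)) - ((\<Sum>i<N. suminf (F i)) - (\<Sum>i<N. \<Sum>j<N. F i j)))
      \<longlonglongrightarrow> (\<Sum>i. suminf (F i)) - 0"
    by (rule tendsto_diff)
  then show "(\<lambda>N. \<Sum>i<N. \<Sum>j<N. F i j) \<longlonglongrightarrow> (\<Sum>i. suminf (F i))"
    by simp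
qed

lemma sums_swap_ultrametric:
  fixes F :: "nat \<Rightarrow> nat \<Rightarrow> 'a::{nonarch_valued_field, complete_space}"
  assumes F: "\<And>e. 0 < e \<Longrightarrow> \<exists>N. \<forall>i j. N \<le> i \<or> N \<le> j \<longrightarrow> vabs (F i j) \<le> e"
  shows "(\<lambda>j. \<Sum>i. F i j) sums (\<Sum>i. \<Sum>j. F i j)"
proof -
  have F': "\<And>e. 0 < e \<Longrightarrow> \<exists>N. \<forall>j i. N \<le> j \<or> N \<le> i \<longrightarrow> vabs (F i j) \<le> e"
    using F by blast
  note cols = square_sums_tendsto[of "\<lambda>j i. F i j", OF F']
  have "(\<lambda>N. \<Sum>j<N. \<Sum>i<N. F i j) \<longlonglongrightarrow> (\<Sum>i. \<Sum>j. F i j)"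
    using square_sums_tendsto(2)[OF F] by (subst sum.swap)
  then have "(\<Sum>j. \<Sum>i. F i j) = (\<Sum>i. \<Sum>j. F i j)"
    using cols(2) by (rule LIMSEQ_unique[rotated])
  then show ?thesis
    using summable_sums[OF summable_ultrametric[OF cols(1)]] by simp
qed

text \<open>
  The ultrametric form of the Weierstrass criterion: the remainder after \<open>N\<close> terms is bounded by
  the supremum of the later \<open>b n\<close>, uniformly in \<open>s\<close>.
\<close>

lemma uniform_limit_ultrametric_series:
  fixes u :: "nat \<Rightarrow> 'b \<Rightarrow> 'a::{nonarch_valued_field, complete_space}"
  assumes u: "\<And>n s. s \<in> S \<Longrightarrow> vabs (u n s) \<le> b n" and b: "b \<longlonglongrightarrow> 0"
  shows "uniform_limit S (\<lambda>N s. \<Sum>n<N. u n s) (\<lambda>s. \<Sum>n. u n s) sequentially"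
proof (rule uniform_limitI)
  fix e :: real assume e: "0 < e"
  then obtain N where N: "\<And>n. n \<ge> N \<Longrightarrow> \<bar>b n\<bar> < e / 2"
    using b[THEN LIMSEQ_D, of "e / 2"] by auto
  have "dist (\<Sum>n<M. u n s) (\<Sum>n. u n s) < e" if M: "N \<le> M" and s: "s \<in> S" for M s
  proof -
    have "(\<lambda>n. u n s) \<longlonglongrightarrow> 0"
      by (rule tendsto_vabs_bound[OF _ b]) (use u[OF s] in simp)
    then have "vabs ((\<Sum>n. u n s) - (\<Sum>n<M. u n s)) \<le> e / 2"
    proof (rule suminf_tail_le)
      fix n assume "M \<le> n"
      then show "vabs (u n s) \<le> e / 2"
        using N[of n] u[OF s, of n] M by linarith
    qed
    then show ?thesis
      using e by (simp add: dist_vabs vabs_minus_commute[of "\<Sum>n<M. u n s"])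
  qed
  then show "\<forall>\<^sub>F N in sequentially. \<forall>s\<in>S. dist (\<Sum>n<N. u n s) (\<Sum>n. u n s) < e"
    by (auto simp: eventually_sequentially)
qed

section \<open>Coefficients of polynomials on a disc\<close>

text \<open>
  The bound \<open>B\<close> dominates the Gauss norm of \<open>P\<close> on the disc of radius \<open>r\<close>,
  which is the largest \<open>vabs (coeff P i) * r ^ i\<close>.
\<close>

definition gauss_le :: "real \<Rightarrow> 'a::nonarch_valued_field poly \<Rightarrow> real \<Rightarrow> bool" where
  "gauss_le r P B \<longleftrightarrow> (\<forall>i. vabs (coeff P i) * r ^ i \<le> B)"

lemma gauss_le_mult:
  assumes "gauss_le r P A" "gauss_le r Q B" "0 < r"
  shows "gauss_le r (P * Q) (A * B)"
  unfolding gauss_le_def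
proof
  fix i
  have A: "0 \<le> A" and B: "0 \<le> B"
    using assms(1,2)[unfolded gauss_le_def, rule_format, of 0] order_trans[OF vabs_nonneg] by auto
  have "vabs (coeff P j * coeff Q (i - j)) * r ^ i \<le> A * B" if "j \<le> i" for j
  proof -
    have "r ^ i = r ^ j * r ^ (i - j)" using that by (simp flip: power_add)
    then have "vabs (coeff P j * coeff Q (i - j)) * r ^ i
        = (vabs (coeff P j) * r ^ j) * (vabs (coeff Q (i - j)) * r ^ (i - j))"
      by (simp add: vabs_mult)
    also have "\<dots> \<le> A * B"
      using assms A by (intro mult_mono) (auto simp: gauss_le_def)
    finally show ?thesis .
  qed
  then have le: "vabs (coeff P j * coeff Q (i - j)) * r ^ i \<le> A * B" if "j \<in> {..i}" for j
    using that by auto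
  have r: "0 < r ^ i" using assms by simp
  have "vabs (\<Sum>j\<le>i. coeff P j * coeff Q (i - j)) \<le> A * B / r ^ i"
    using le r A B by (intro vabs_sum_le) (auto simp: pos_le_divide_eq)
  then show "vabs (coeff (P * Q) i) * r ^ i \<le> A * B"
    using r by (simp add: coeff_mult pos_le_divide_eq)
qed

text \<open>
  The polynomial \<open>h \<mapsto> n! * binomial(x + h, n)\<close>. It is kept as a product of linear
  factors because the Gauss norm can be bounded factor by factor.
\<close>

definition falling_poly :: "'a::nonarch_valued_field \<Rightarrow> nat \<Rightarrow> 'a poly" where
  "falling_poly x n = (\<Prod>k<n. [:x - of_nat k, 1:])"

lemma poly_falling_poly:
  "poly (falling_poly x n) h = fact n * ((x + h) gchoose n)"
  by (simp add: falling_poly_def poly_prod gbinomial_mult_fact atLeast0LessThan algebra_simps)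

lemma gauss_le_falling_poly:
  assumes "0 < r"
  shows "gauss_le r (falling_poly x n) (\<Prod>k<n. max r (vabs (x - of_nat k)))"
proof (induction n)
  case 0
  then show ?case by (auto simp: gauss_le_def falling_poly_def coeff_1)
next
  case (Suc n)
  have "gauss_le r [:x - of_nat n, 1:] (max r (vabs (x - of_nat n)))"
    using assms by (auto simp: gauss_le_def coeff_pCons le_max_iff_disj split: nat.split)
  from gauss_le_mult[OF Suc this assms] show ?case
    by (simp add: falling_poly_def)
qed

section \<open>The ring of p-adic integers\<close>

text \<open>
  The \<open>p\<close>-adic size of the integers carries all the arithmetic: the density of the natural
  numbers in \<open>Zp\<close>, its compactness, and the decay of the factorials.
\<close>

locale padic_complete_field =
  fixes p :: nat and T :: "'a::{nonarch_valued_field, complete_space} itself"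
  assumes prime_p: "prime p"
    and vabs_of_int_padic:
      "k \<noteq> 0 \<Longrightarrow> vabs (of_int k :: 'a) = (1 / real p) ^ multiplicity (int p) k"
begin

lemma p_gt_1: "1 < real p"
  using prime_gt_1_nat[OF prime_p] by simp

lemma inverse_p_bounds: "0 < 1 / real p" "1 / real p < 1"
  using p_gt_1 by auto

lemma vabs_of_int_le_power:
  assumes "int p ^ m dvd k"
  shows "vabs (of_int k :: 'a) \<le> (1 / real p) ^ m"
proof (cases "k = 0")
  case False
  have "\<not> is_unit (int p)"
    using prime_p not_prime_unit prime_nat_int_transfer by blast
  then have "m \<le> multiplicity (int p) k"
    using False assms by (intro multiplicity_geI) auto
  then show ?thesis
    using False p_gt_1 by (simp add: vabs_of_int_padic power_decreasing)
qed simp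

lemma vabs_of_int_le_1: "vabs (of_int k :: 'a) \<le> 1"
  using vabs_of_int_le_power[of 0 k] by simp

lemma vabs_of_nat_le_1: "vabs (of_nat k :: 'a) \<le> 1"
  using vabs_of_int_le_1[of "int k"] by simp

text \<open>
  A rational number of absolute value at most one has, in lowest terms, a denominator prime to
  \<open>p\<close>. That denominator is invertible modulo every power of \<open>p\<close>, which solves the
  congruence for \<open>k\<close>.
\<close>

lemma Rats_unit_ball_approx_nat:
  fixes y :: 'a
  assumes "y \<in> \<rat>" "vabs y \<le> 1"
  obtains k :: nat where "vabs (y - of_nat k) \<le> (1 / real p) ^ m"
proof -
  obtain r where "y = of_rat r" using assms by (auto elim: Rats_cases)
  moreover obtain a b where "r = Fract a b" "0 < b" "coprime a b" by (cases r)
  ultimately have y: "y = of_int a / of_int b" and b: "b \<noteq> 0" and ab: "coprime a b"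
    by (auto simp: of_rat_rat)
  have unit: "\<not> int p dvd b"
  proof
    assume pb: "int p dvd b"
    then have "\<not> int p dvd a"
      using ab prime_p by (metis coprime_common_divisor not_prime_unit prime_nat_int_transfer)
    then have "a \<noteq> 0" by auto
    then have a: "vabs (of_int a :: 'a) = 1"
      using \<open>\<not> int p dvd a\<close> by (simp add: vabs_of_int_padic not_dvd_imp_multiplicity_0)
    have "vabs (of_int b :: 'a) \<le> 1 / real p"
      using vabs_of_int_le_power[of 1 b] pb by simp
    then have "vabs (of_int b :: 'a) < 1"
      using inverse_p_bounds by linarith
    moreover have "0 < vabs (of_int b :: 'a)"
      using b by (simp add: less_le)
    ultimately have "1 < vabs y" by (simp add: y vabs_divide a)
    with assms show False by simp
  qed
  then have vb: "vabs (of_int b :: 'a) = 1"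
    using b by (simp add: vabs_of_int_padic not_dvd_imp_multiplicity_0)
  have "coprime (int p) b"
    using unit prime_p by (simp add: prime_imp_coprime)
  then have "coprime b (int p ^ m)"
    by (simp add: coprime_commute)
  then obtain u v where uv: "u * b + v * int p ^ m = 1"
    using bezout_int[of b "int p ^ m"] by auto
  define k where "k = nat ((u * a) mod int p ^ m)"
  have k: "int k = u * a - int p ^ m * (u * a div int p ^ m)"
    using prime_gt_0_nat[OF prime_p] by (simp add: k_def minus_mult_div_eq_mod)
  have "a - b * int k = a * (u * b + v * int p ^ m) - b * int k"
    by (simp add: uv)
  also have "\<dots> = int p ^ m * (v * a + b * (u * a div int p ^ m))"
    unfolding k by (simp add: algebra_simps)
  finally have "int p ^ m dvd a - b * int k" by simp
  then have "vabs (of_int (a - b * int k) :: 'a) \<le> (1 / real p) ^ m"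
    by (rule vabs_of_int_le_power)
  moreover have "y - of_nat k = of_int (a - b * int k) / of_int b"
    using b by (simp add: y field_simps)
  ultimately have "vabs (y - of_nat k) \<le> (1 / real p) ^ m"
    by (simp add: vabs_divide vb)
  then show thesis by (rule that)
qed

lemma Zp_approx_nat:
  fixes x :: 'a
  assumes "x \<in> Zp"
  shows "\<exists>k::nat. vabs (x - of_nat k) \<le> (1 / real p) ^ m"
proof -
  have x: "x \<in> closure \<rat>" "vabs x \<le> 1" using assms by (auto simp: Zp_def Qp_def)
  have "0 < (1 / real p) ^ m" using inverse_p_bounds by simp
  then obtain y where y: "y \<in> \<rat>" "dist y x < (1 / real p) ^ m"
    using x(1) unfolding closure_approachable by blast
  have le1: "(1 / real p) ^ m \<le> 1" using p_gt_1 by (simp add: power_le_one)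
  have "vabs (x + (y - x)) \<le> 1"
    using y x le1 by (intro vabs_add_le) (auto simp: dist_vabs)
  then have "vabs y \<le> 1" by simp
  then obtain k :: nat where k: "vabs (y - of_nat k) \<le> (1 / real p) ^ m"
    using Rats_unit_ball_approx_nat y(1) by blast
  have "vabs ((x - y) + (y - of_nat k)) \<le> (1 / real p) ^ m"
    using y(2) k by (intro vabs_add_le) (auto simp: dist_vabs vabs_minus_commute[of x])
  then show ?thesis by (intro exI[of _ k]) simp
qed

lemma of_int_in_Zp: "(of_int k :: 'a) \<in> Zp"
  using closure_subset[of "\<rat> :: 'a set"] vabs_of_int_le_1 by (auto simp: Zp_def Qp_def)

lemma of_nat_in_Zp: "(of_nat k :: 'a) \<in> Zp"
  using of_int_in_Zp[of "int k"] by simp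

lemma neg_succ_in_Zp: "- 1 - of_nat n \<in> (Zp :: 'a set)"
  using of_int_in_Zp[of "- 1 - int n"] by simp

lemma closed_Zp: "closed (Zp :: 'a set)"
proof -
  have "(Zp :: 'a set) = closure \<rat> \<inter> cball 0 1"
    by (auto simp: Zp_def Qp_def vabs_eq_dist dist_commute)
  then show ?thesis by (metis closed_Int closed_cball closed_closure)
qed

lemma inverse_p_powers_tendsto: "(\<lambda>m. (1 / real p) ^ m) \<longlonglongrightarrow> 0"
  using inverse_p_bounds by (intro LIMSEQ_power_zero) auto

lemma Zp_limitI:
  fixes x :: 'a
  assumes "\<And>m. y m \<in> Zp" "\<And>m. vabs (x - y m) \<le> (1 / real p) ^ m"
  shows "y \<longlonglongrightarrow> x" "x \<in> Zp"
proof -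
  show "y \<longlonglongrightarrow> x"
    by (rule tendsto_vabs_bound[OF _ inverse_p_powers_tendsto])
      (use assms(2) in \<open>simp add: vabs_minus_commute\<close>)
  then show "x \<in> Zp"
    using closed_Zp assms(1) closed_sequentially by blast
qed

lemma Zp_add_1:
  fixes x :: 'a
  assumes "x \<in> Zp"
  shows "x + 1 \<in> Zp"
proof -
  obtain k :: "nat \<Rightarrow> nat" where k: "\<And>m. vabs (x - of_nat (k m)) \<le> (1 / real p) ^ m"
    using Zp_approx_nat[OF assms] by metis
  show ?thesis
  proof (rule Zp_limitI(2))
    show "of_nat (Suc (k m)) \<in> (Zp :: 'a set)" for m by (rule of_nat_in_Zp)
    show "vabs (x + 1 - of_nat (Suc (k m))) \<le> (1 / real p) ^ m" for m
      using k[of m] by simp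
  qed
qed

text \<open>
  The transform sees a function only at the points \<open>- 1 - n\<close>. They are dense as well:
  modulo \<open>p ^ m\<close>, every natural number \<open>k\<close> is congruent to such a point.
\<close>

lemma Zp_approx_neg_succ:
  fixes x :: 'a
  assumes "x \<in> Zp"
  shows "\<exists>n::nat. vabs (x - (- 1 - of_nat n)) \<le> (1 / real p) ^ m"
proof -
  obtain k :: nat where k: "vabs (x - of_nat k) \<le> (1 / real p) ^ m"
    using Zp_approx_nat assms by blast
  \<comment> \<open>This choice gives \<open>k - (- 1 - n) = (k + 1) * p ^ m\<close>.\<close>
  define n where "n = (k + 1) * (p ^ m - 1)"
  have "1 \<le> p ^ m" using prime_gt_0_nat[OF prime_p] by simp
  then have "int (p ^ m - 1) = int p ^ m - 1" by (simp add: of_nat_diff)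
  then have "int n = (int k + 1) * (int p ^ m - 1)"
    by (simp only: n_def of_nat_mult of_nat_add of_nat_1)
  then have "int k - (- 1 - int n) = int p ^ m * (int k + 1)"
    by (simp add: algebra_simps)
  then have "vabs (of_int (int k - (- 1 - int n)) :: 'a) \<le> (1 / real p) ^ m"
    by (intro vabs_of_int_le_power) simp
  then have "vabs ((x - of_nat k) + (of_nat k - (- 1 - of_nat n))) \<le> (1 / real p) ^ m"
    using k by (intro vabs_add_le) auto
  then show ?thesis by (intro exI[of _ n]) (simp add: algebra_simps)
qed

lemma continuous_on_Zp_eqI:
  fixes f g :: "'a \<Rightarrow> 'b::t2_space"
  assumes f: "continuous_on Zp f" and g: "continuous_on Zp g"
    and S: "\<And>n. S n \<in> Zp" "\<And>x m. x \<in> Zp \<Longrightarrow> \<exists>n::nat. vabs (x - S n) \<le> (1 / real p) ^ m"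
    and eq: "\<And>n. f (S n) = g (S n)"
    and x: "x \<in> Zp"
  shows "f x = g x"
proof -
  obtain k where k: "\<And>m. vabs (x - S (k m)) \<le> (1 / real p) ^ m"
    using S(2)[OF x] by metis
  have lim: "(\<lambda>m. S (k m)) \<longlonglongrightarrow> x"
    using k S(1) by (intro Zp_limitI(1))
  have "(\<lambda>m. f (S (k m))) \<longlonglongrightarrow> f x" "(\<lambda>m. g (S (k m))) \<longlonglongrightarrow> g x"
    using S(1) x by (auto intro!: continuous_on_tendsto_compose[OF f lim] continuous_on_tendsto_compose[OF g lim])
  then show ?thesis unfolding eq by (rule LIMSEQ_unique)
qed

text \<open>
  The natural numbers below \<open>p ^ m\<close> form a finite net of mesh \<open>p ^ (- m)\<close>, so \<open>Zp\<close> is totally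
  bounded; it is complete as a closed subset of a complete space.
\<close>

lemma compact_Zp: "compact (Zp :: 'a set)"
  unfolding compact_eq_totally_bounded
proof (intro conjI allI impI)
  show "complete (Zp :: 'a set)"
    using closed_Zp by (simp add: complete_eq_closed)
  fix e :: real assume "0 < e"
  then obtain m where m: "(1 / real p) ^ m < e"
    using inverse_p_bounds real_arch_pow_inv by blast
  have "\<exists>y\<in>of_nat ` {..<p ^ m}. dist y x < e" if x: "x \<in> Zp" for x :: 'a
  proof -
    obtain k :: nat where k: "vabs (x - of_nat k) \<le> (1 / real p) ^ m"
      using Zp_approx_nat[OF x] by blast
    have "int p ^ m dvd int k - int (k mod p ^ m)"
      by (metis minus_mod_eq_mult_div dvd_triv_left of_nat_mod of_nat_power)
    then have "vabs (of_int (int k - int (k mod p ^ m)) :: 'a) \<le> (1 / real p) ^ m"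
      by (rule vabs_of_int_le_power)
    then have "vabs ((x - of_nat k) + (of_nat k - of_nat (k mod p ^ m))) \<le> (1 / real p) ^ m"
      using k by (intro vabs_add_le) auto
    then have "dist (of_nat (k mod p ^ m)) x < e"
      using m by (simp add: dist_vabs vabs_minus_commute)
    then show ?thesis using prime_gt_0_nat[OF prime_p] by auto
  qed
  then show "\<exists>k. finite k \<and> (Zp :: 'a set) \<subseteq> (\<Union>x\<in>k. ball x e)"
    by (intro exI[of _ "of_nat ` {..<p ^ m}"]) (auto simp: subset_iff)
qed

section \<open>Binomial coefficients on the p-adic integers\<close>

lemma continuous_on_gbinomial: "continuous_on S (\<lambda>x::'a. x gchoose n)"
  unfolding gbinomial_prod_rev divide_inverse
  by (intro continuous_on_mult' continuous_on_prod' continuous_on_diff continuous_on_id continuous_on_const)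

text \<open>
  Ordinary binomial coefficients are integers; the bound passes to all of \<open>Zp\<close> by density and
  continuity.
\<close>

lemma vabs_gbinomial_le_1:
  fixes s :: 'a
  assumes "s \<in> Zp"
  shows "vabs (s gchoose n) \<le> 1"
proof -
  obtain k :: "nat \<Rightarrow> nat" where k: "\<And>m. vabs (s - of_nat (k m)) \<le> (1 / real p) ^ m"
    using Zp_approx_nat[OF assms] by metis
  have lim: "(\<lambda>m. of_nat (k m)) \<longlonglongrightarrow> s"
    using k of_nat_in_Zp by (rule Zp_limitI(1)[rotated])
  have "(\<lambda>m. of_nat (k m) gchoose n) \<longlonglongrightarrow> (s gchoose n)"
    by (rule continuous_on_tendsto_compose[OF continuous_on_gbinomial[of UNIV] lim]) auto
  then show ?thesis
    by (rule vabs_limit_le) (simp add: vabs_of_nat_le_1 flip: binomial_gbinomial)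
qed

text \<open>
  An explicit null sequence that dominates the absolute value of \<open>n!\<close>. The exponent counts
  only the multiples of \<open>p\<close> among \<open>1, \<dots>, n\<close>, not those of higher powers.
\<close>

definition decay :: "nat \<Rightarrow> real" where
  "decay n = (1 / real p) ^ (n div p)"

lemma decay_tendsto_0: "decay \<longlonglongrightarrow> 0"
proof -
  have "filterlim (\<lambda>n. n div p) at_top sequentially"
    unfolding filterlim_at_top
  proof
    fix Z
    have "Z \<le> n div p" if "Z * p \<le> n" for n
      using that prime_gt_0_nat[OF prime_p] by (simp add: less_eq_div_iff_mult_less_eq)
    then show "\<forall>\<^sub>F n in sequentially. Z \<le> n div p"
      by (auto simp: eventually_sequentially)
  qed
  from filterlim_compose[OF inverse_p_powers_tendsto this] show ?thesis
    by (simp add: decay_def[abs_def])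
qed

lemma decay_bounds: "0 < decay n" "decay n \<le> 1"
  using inverse_p_bounds p_gt_1 by (auto simp: decay_def power_le_one)

lemma decay_antimono: "m \<le> n \<Longrightarrow> decay n \<le> decay m"
  using p_gt_1 unfolding decay_def by (intro power_decreasing div_le_mono) auto

text \<open>
  Among any \<open>p\<close> consecutive integers one is congruent to \<open>x\<close> modulo \<open>p\<close>. The
  corresponding linear factor has Gauss norm \<open>1 / p\<close> on the disc of radius \<open>1 / p\<close>,
  and the others have Gauss norm at most one.
\<close>

lemma falling_poly_decay:
  fixes x :: 'a
  assumes x: "x \<in> Zp"
  shows "gauss_le (1 / real p) (falling_poly x n) (decay n)"
proof -
  let ?r = "1 / real p"
  define g where "g k = max ?r (vabs (x - of_nat k))" for k
  have p0: "0 < p" using prime_gt_0_nat[OF prime_p] .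
  obtain j :: nat where j: "vabs (x - of_nat j) \<le> ?r ^ 1"
    using Zp_approx_nat[OF x] by blast
  have g1: "0 \<le> g k" "g k \<le> 1" for k
  proof -
    show "0 \<le> g k" using inverse_p_bounds by (simp add: g_def le_max_iff_disj)
    have "vabs (x - of_nat k) \<le> 1"
      using x vabs_of_nat_le_1 by (intro vabs_diff_le) (auto simp: Zp_def)
    then show "g k \<le> 1" using inverse_p_bounds by (simp add: g_def)
  qed
  \<comment> \<open>The indices of the factors that are small, one in each complete block of length \<open>p\<close>.\<close>
  define A where "A = (\<lambda>l. j mod p + p * l) ` {..<n div p}"
  have "inj_on (\<lambda>l. j mod p + p * l) {..<n div p}"
    using p0 by (auto simp: inj_on_def)
  then have card: "card A = n div p" by (simp add: A_def card_image)
  have sub: "A \<subseteq> {..<n}"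
  proof
    fix k assume "k \<in> A"
    then obtain l where l: "l < n div p" "k = j mod p + p * l" by (auto simp: A_def)
    then have "k < p + p * l" using p0 by simp
    also have "\<dots> = p * Suc l" by simp
    also have "\<dots> \<le> p * (n div p)" using l by (intro mult_le_mono2) simp
    also have "\<dots> \<le> n" by simp
    finally show "k \<in> {..<n}" by simp
  qed
  have gA: "g k \<le> ?r" if k: "k \<in> A" for k
  proof -
    obtain l where l: "k = j mod p + p * l" using k by (auto simp: A_def)
    have "int j mod int p = int k mod int p"
      by (simp add: l zmod_int)
    then have "int p ^ 1 dvd int j - int k"
      by (simp add: mod_eq_dvd_iff)
    then have "vabs (of_int (int j - int k) :: 'a) \<le> ?r ^ 1"
      by (rule vabs_of_int_le_power)
    then have "vabs ((x - of_nat j) + (of_nat j - of_nat k)) \<le> ?r ^ 1"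
      using j by (intro vabs_add_le) auto
    then show ?thesis by (simp add: g_def)
  qed
  have "(\<Prod>k<n. g k) = (\<Prod>k\<in>{..<n} - A. g k) * (\<Prod>k\<in>A. g k)"
    using sub by (rule prod.subset_diff) simp
  also have "\<dots> \<le> 1 * (\<Prod>k\<in>A. ?r)"
    using g1 gA by (intro mult_mono prod_le_1 prod_mono prod_nonneg) auto
  also have "\<dots> = decay n" by (simp add: card decay_def)
  finally have "(\<Prod>k<n. g k) \<le> decay n" .
  with gauss_le_falling_poly[OF inverse_p_bounds(1), of x n] show ?thesis
    unfolding gauss_le_def g_def by (meson order_trans)
qed

text \<open>
  The factorial is the constant coefficient of the falling polynomial at \<open>x = n\<close>, so it
  inherits the bound.
\<close>

lemma vabs_fact_le_decay: "vabs (fact n :: 'a) \<le> decay n"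
proof -
  have "coeff (falling_poly (of_nat n) n) 0 = (fact n :: 'a)"
    using poly_falling_poly[of "of_nat n :: 'a" n 0]
    by (simp add: poly_0_coeff_0 flip: binomial_gbinomial)
  with falling_poly_decay[OF of_nat_in_Zp[of n], of n] show ?thesis
    unfolding gauss_le_def by (metis mult.right_neutral power_0)
qed

end

section \<open>Finite differences\<close>

definition fdiff :: "(nat \<Rightarrow> 'a::ab_group_add) \<Rightarrow> nat \<Rightarrow> 'a" where
  "fdiff f n = f (Suc n) - f n"

text \<open>
  Newton's formula. At \<open>n = 0\<close> it recovers the values of \<open>f\<close> from its differences at \<open>0\<close>, and
  with \<open>N\<close> a power of \<open>p\<close> it expresses the \<open>N\<close>-th difference through a shift and
  lower differences.
\<close>

lemma newton_forward:
  fixes f :: "nat \<Rightarrow> 'a::comm_ring_1"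
  shows "f (n + N) = (\<Sum>j\<le>N. of_nat (N choose j) * (fdiff ^^ j) f n)"
proof (induction N arbitrary: f)
  case (Suc N)
  define d where "d j = (fdiff ^^ j) f n" for j
  have d: "(fdiff ^^ j) (fdiff f) n = d (Suc j)" for j
    by (simp add: d_def funpow_swap1)
  have "f (n + Suc N) = f (n + N) + fdiff f (n + N)"
    by (simp add: fdiff_def)
  also have "fdiff f (n + N) = (\<Sum>j\<le>N. of_nat (N choose j) * d (Suc j))"
    unfolding Suc[of "fdiff f"] d ..
  also have "f (n + N) = (\<Sum>j\<le>Suc N. of_nat (N choose j) * d j)"
    unfolding Suc[of f] by (simp add: d_def binomial_eq_0)
  also have "\<dots> = d 0 + (\<Sum>j\<le>N. of_nat (N choose Suc j) * d (Suc j))"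
    by (simp only: sum.atMost_Suc_shift) simp
  also have "\<dots> + (\<Sum>j\<le>N. of_nat (N choose j) * d (Suc j))
      = (\<Sum>j\<le>Suc N. of_nat (Suc N choose j) * d j)"
    by (simp only: sum.atMost_Suc_shift) (simp add: algebra_simps sum.distrib)
  finally show ?case by (simp add: d_def)
qed simp

lemma fdiff_funpow_shift:
  fixes f :: "nat \<Rightarrow> 'a::ab_group_add"
  shows "(fdiff ^^ j) (\<lambda>n. f (n + s) - f n) n = (fdiff ^^ j) f (n + s) - (fdiff ^^ j) f n"
proof (induction j arbitrary: n)
  case (Suc j)
  have "(fdiff ^^ Suc j) g m = (fdiff ^^ j) g (Suc m) - (fdiff ^^ j) g m" for g :: "nat \<Rightarrow> 'a" and m
    by (simp add: fdiff_def)
  then show ?case by (simp only: Suc add_Suc) (simp add: algebra_simps)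
qed simp

lemma vabs_fdiff_funpow_le:
  fixes f :: "nat \<Rightarrow> 'a::nonarch_valued_field"
  assumes "\<And>n. vabs (f n) \<le> M"
  shows "vabs ((fdiff ^^ j) f n) \<le> M"
proof (induction j arbitrary: n)
  case (Suc j)
  show ?case using vabs_diff_le[OF Suc[of "Suc n"] Suc[of n]] by (simp add: fdiff_def)
qed (use assms in simp)

text \<open>
  The system of equations is triangular with ones on the diagonal.
\<close>

lemma binomial_transform_inj:
  fixes u v :: "nat \<Rightarrow> 'a::comm_ring_1"
  assumes "\<And>N. (\<Sum>n\<le>N. u n * of_nat (N choose n)) = (\<Sum>n\<le>N. v n * of_nat (N choose n))"
  shows "u = v"
proof
  fix N show "u N = v N"
  proof (induction N rule: less_induct)
    case (less N)
    have "(\<Sum>n\<in>{..<N}. u n * of_nat (N choose n)) = (\<Sum>n\<in>{..<N}. v n * of_nat (N choose n))"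
      using less by (intro sum.cong) auto
    then show ?case
      using assms[of N] by (simp flip: lessThan_Suc_atMost)
  qed
qed

context padic_complete_field
begin

lemma vabs_prime_power_choose_le:
  assumes "0 < j" "j < p ^ t"
  shows "vabs (of_nat (p ^ t choose j) :: 'a) \<le> 1 / real p"
proof -
  have "p dvd (p ^ t choose j)"
  proof (rule ccontr)
    assume "\<not> p dvd (p ^ t choose j)"
    then have "coprime (p ^ t) (p ^ t choose j)"
      using prime_p by (simp add: prime_imp_coprime)
    moreover have "p ^ t dvd j * (p ^ t choose j)"
      using times_binomial_minus1_eq[OF assms(1), of "p ^ t"] by simp
    ultimately have "p ^ t dvd j"
      by (simp add: coprime_dvd_mult_left_iff)
    with assms show False by (auto dest: dvd_imp_le)
  qed
  then have "int p ^ 1 dvd int (p ^ t choose j)" by (simp only: power_one_right of_nat_dvd_iff)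
  from vabs_of_int_le_power[OF this] show ?thesis by simp
qed

text \<open>
  In Newton's formula for the shift by \<open>p ^ t\<close> all inner binomial coefficients are divisible by
  \<open>p\<close>. Hence the difference of order \<open>p ^ t\<close> equals the increment under that shift up to
  an error of at most \<open>1 / p\<close> times the bound on the function.
\<close>

lemma fdiff_prime_power_contraction:
  fixes g :: "nat \<Rightarrow> 'a"
  assumes g: "\<And>n. vabs (g n) \<le> B" and shift: "\<And>n. vabs (g (n + p ^ t) - g n) \<le> e"
  shows "vabs ((fdiff ^^ (p ^ t)) g n) \<le> max e (B / real p)"
proof -
  let ?N = "p ^ t" and ?d = "\<lambda>j. (fdiff ^^ j) g n"
  have N: "0 < ?N" using prime_gt_0_nat[OF prime_p] by simp
  have B: "0 \<le> B" using g[of 0] vabs_nonneg order_trans by blast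
  have "{..?N} = insert 0 (insert ?N {1..<?N})" using N by auto
  then have "g (n + ?N) = ?d 0 + (?d ?N + (\<Sum>j\<in>{1..<?N}. of_nat (?N choose j) * ?d j))"
    using N by (subst newton_forward) simp
  then have eq: "?d ?N = (g (n + ?N) - g n) - (\<Sum>j\<in>{1..<?N}. of_nat (?N choose j) * ?d j)"
    by (simp add: algebra_simps)
  have "vabs (\<Sum>j\<in>{1..<?N}. of_nat (?N choose j) * ?d j) \<le> B / real p"
  proof (rule vabs_sum_le)
    fix j assume "j \<in> {1..<?N}"
    then have "vabs (of_nat (?N choose j) :: 'a) * vabs (?d j) \<le> 1 / real p * B"
      using vabs_fdiff_funpow_le[where f = g, OF g] by (intro mult_mono vabs_prime_power_choose_le) auto
    then show "vabs (of_nat (?N choose j) * ?d j) \<le> B / real p"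
      by (simp add: vabs_mult)
  qed (use B in simp)
  then show ?thesis
    unfolding eq using shift[of n] by (intro vabs_diff_le[of "g (n + ?N) - g n"]) (simp_all add: le_max_iff_disj)
qed

text \<open>
  Differences commute with shifts, so the bound \<open>e\<close> on the increments persists and the contraction
  can be applied again to the function already obtained.
\<close>

lemma fdiff_iterated_contraction:
  fixes f :: "nat \<Rightarrow> 'a"
  assumes f: "\<And>n. vabs (f n) \<le> M" and shift: "\<And>n. vabs (f (n + p ^ t) - f n) \<le> e"
  shows "vabs ((fdiff ^^ (m * p ^ t)) f n) \<le> max e (M / real p ^ m)"
proof (induction m arbitrary: n)
  case 0
  then show ?case using f[of n] by simp
next
  case (Suc m)
  let ?g = "(fdiff ^^ (m * p ^ t)) f"
  have e: "0 \<le> e" using shift[of 0] vabs_nonneg order_trans by blast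
  have "vabs (?g (n + p ^ t) - ?g n) \<le> e" for n
    unfolding fdiff_funpow_shift[symmetric] by (rule vabs_fdiff_funpow_le) (rule shift)
  then have "vabs ((fdiff ^^ (p ^ t)) ?g n) \<le> max e (max e (M / real p ^ m) / real p)"
    by (intro fdiff_prime_power_contraction Suc)
  also have "\<dots> \<le> max e (M / real p ^ Suc m)"
  proof -
    have "e * 1 \<le> e * real p" using e p_gt_1 by (intro mult_left_mono) auto
    then have "e / real p \<le> e" using p_gt_1 by (simp add: divide_le_eq)
    then have "max e (M / real p ^ m) / real p \<le> max e (M / real p ^ m / real p)"
      by (cases "e \<le> M / real p ^ m") auto
    then show ?thesis by (simp add: mult.commute)
  qed
  finally show ?case by (simp add: funpow_add)
qed

lemma fdiff_tendsto_0:
  fixes f :: "nat \<Rightarrow> 'a"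
  assumes f: "\<And>n. vabs (f n) \<le> M"
    and shift: "\<And>e. 0 < e \<Longrightarrow> \<exists>t. \<forall>n. vabs (f (n + p ^ t) - f n) \<le> e"
  shows "(\<lambda>j. (fdiff ^^ j) f 0) \<longlonglongrightarrow> 0"
proof (rule LIMSEQ_0_vabsI)
  fix e :: real assume e: "0 < e"
  then obtain t where t: "\<And>n. vabs (f (n + p ^ t) - f n) \<le> e" using shift by blast
  have "(\<lambda>m. M * (1 / real p) ^ m) \<longlonglongrightarrow> M * 0"
    by (intro tendsto_mult tendsto_const inverse_p_powers_tendsto)
  then obtain m where m: "M * (1 / real p) ^ m < e"
    using e order_tendstoD(2)[of _ 0 sequentially e] by (auto simp: eventually_sequentially)
  have le: "vabs ((fdiff ^^ (m * p ^ t)) f n) \<le> e" for n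
    using fdiff_iterated_contraction[where f = f and M = M and t = t and e = e and m = m and n = n, OF f t] m
    by (simp add: power_divide)
  have "vabs ((fdiff ^^ j) f 0) \<le> e" if j: "m * p ^ t \<le> j" for j
  proof -
    obtain k where k: "j = m * p ^ t + k" using le_Suc_ex[OF j] ..
    have "(fdiff ^^ j) f = (fdiff ^^ k) ((fdiff ^^ (m * p ^ t)) f)"
      unfolding k by (subst add.commute) (simp only: funpow_add comp_apply)
    then show ?thesis
      using vabs_fdiff_funpow_le[where f = "(fdiff ^^ (m * p ^ t)) f", OF le] by simp
  qed
  then show "\<exists>N. \<forall>j\<ge>N. vabs ((fdiff ^^ j) f 0) \<le> e" by blast
qed

section \<open>Mahler expansions\<close>

lemma continuous_Zp_bounded:
  fixes \<psi> :: "'a \<Rightarrow> 'a"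
  assumes "\<psi> \<in> continuous_Zp"
  obtains M where "\<And>x. x \<in> Zp \<Longrightarrow> vabs (\<psi> x) \<le> M"
proof -
  have "bounded (\<psi> ` Zp)"
    using assms compact_Zp by (auto simp: continuous_Zp_def intro: compact_imp_bounded compact_continuous_image)
  then obtain M where "\<forall>y\<in>\<psi> ` Zp. dist 0 y \<le> M"
    using bounded_any_center by blast
  then show thesis
    by (intro that[of M]) (auto simp: vabs_eq_dist dist_commute)
qed

text \<open>
  The continuous function on \<open>Zp\<close> with Mahler coefficients \<open>a\<close>, extended to the whole
  field in the same way as the members of \<^const>\<open>continuous_Zp\<close>.
\<close>

definition mahler :: "(nat \<Rightarrow> 'a) \<Rightarrow> 'a \<Rightarrow> 'a" where
  "mahler a = (\<lambda>x\<in>Zp. \<Sum>k. a k * (x gchoose k))"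

lemma mahler_continuous:
  assumes "a \<longlonglongrightarrow> 0"
  shows "mahler a \<in> continuous_Zp"
proof -
  have lim: "uniform_limit Zp (\<lambda>N x. \<Sum>k<N. a k * (x gchoose k)) (\<lambda>x. \<Sum>k. a k * (x gchoose k)) sequentially"
  proof (rule uniform_limit_ultrametric_series)
    show "(\<lambda>k. vabs (a k)) \<longlonglongrightarrow> 0" using assms by (simp flip: tendsto_0_vabs_iff)
    show "vabs (a k * (x gchoose k)) \<le> vabs (a k)" if "x \<in> Zp" for k x
      using vabs_mult_le_left[OF vabs_gbinomial_le_1[OF that]] by (simp add: mult.commute)
  qed
  have "continuous_on Zp (\<lambda>x. \<Sum>k. a k * (x gchoose k))"
    by (rule uniform_limit_theorem[OF _ lim])
      (auto intro!: always_eventually continuous_on_sum continuous_on_mult' continuous_on_gbinomial continuous_on_const)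
  then have "continuous_on Zp (mahler a)"
    by (simp add: mahler_def)
  then show ?thesis by (simp add: continuous_Zp_def mahler_def)
qed

lemma mahler_of_nat: "mahler a (of_nat N) = (\<Sum>k\<le>N. a k * of_nat (N choose k))"
proof -
  have "mahler a (of_nat N) = (\<Sum>k. a k * of_nat (N choose k))"
    by (simp add: mahler_def of_nat_in_Zp binomial_gbinomial)
  also have "\<dots> = (\<Sum>k\<le>N. a k * of_nat (N choose k))"
    by (intro suminf_finite) (auto simp: binomial_eq_0)
  finally show ?thesis .
qed

lemma continuous_Zp_eqI:
  fixes f g :: "'a \<Rightarrow> 'a"
  assumes "f \<in> continuous_Zp" "g \<in> continuous_Zp"
    and "\<And>n. S n \<in> Zp" "\<And>x m. x \<in> Zp \<Longrightarrow> \<exists>n::nat. vabs (x - S n) \<le> (1 / real p) ^ m"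
    and "\<And>n. f (S n) = g (S n)"
  shows "f = g"
proof (rule extensionalityI)
  show "f \<in> extensional Zp" "g \<in> extensional Zp"
    using assms by (auto simp: continuous_Zp_def)
  show "f x = g x" if "x \<in> Zp" for x
    by (rule continuous_on_Zp_eqI[of f g S]) (use assms that in \<open>auto simp: continuous_Zp_def\<close>)
qed

text \<open>
  Mahler's theorem. The coefficients are the iterated differences at \<open>0\<close>. They tend to zero because
  compactness makes the function bounded and uniformly continuous, so that the shift by a
  high power of \<open>p\<close> changes it little. The series then agrees with the function on the natural
  numbers, by Newton's formula, and thus everywhere by density.
\<close>

theorem mahler_expansion:
  fixes \<psi> :: "'a \<Rightarrow> 'a"
  assumes "\<psi> \<in> continuous_Zp"
  obtains a where "a \<longlonglongrightarrow> 0" "\<psi> = mahler a"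
proof -
  define f where "f n = \<psi> (of_nat n)" for n
  define a where "a j = (fdiff ^^ j) f 0" for j
  obtain M where M: "\<And>x. x \<in> Zp \<Longrightarrow> vabs (\<psi> x) \<le> M"
    using continuous_Zp_bounded[OF assms] by metis
  have uc: "uniformly_continuous_on Zp \<psi>"
    using assms compact_Zp by (auto simp: continuous_Zp_def intro: compact_uniformly_continuous)
  have "\<exists>t. \<forall>n. vabs (f (n + p ^ t) - f n) \<le> e" if e: "0 < e" for e
  proof -
    obtain d where d: "0 < d" "\<And>x y. x \<in> Zp \<Longrightarrow> y \<in> Zp \<Longrightarrow> dist x y < d \<Longrightarrow> dist (\<psi> x) (\<psi> y) < e"
      using uc e unfolding uniformly_continuous_on_def by metis
    obtain t where t: "(1 / real p) ^ t < d"
      using d inverse_p_bounds real_arch_pow_inv by blast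
    have "vabs (f (n + p ^ t) - f n) \<le> e" for n
    proof -
      have "vabs (of_int (int p ^ t) :: 'a) \<le> (1 / real p) ^ t"
        by (rule vabs_of_int_le_power) simp
      then have "dist (of_nat (n + p ^ t)) (of_nat n :: 'a) < d"
        using t by (simp add: dist_vabs)
      then have "dist (\<psi> (of_nat (n + p ^ t))) (\<psi> (of_nat n)) < e"
        by (intro d of_nat_in_Zp)
      then show ?thesis by (simp add: dist_vabs f_def)
    qed
    then show ?thesis by blast
  qed
  then have a: "a \<longlonglongrightarrow> 0"
    unfolding a_def using M of_nat_in_Zp by (intro fdiff_tendsto_0) (auto simp: f_def)
  have "\<psi> = mahler a"
  proof (rule continuous_Zp_eqI[OF assms mahler_continuous[OF a] of_nat_in_Zp Zp_approx_nat])
    show "\<psi> (of_nat n) = mahler a (of_nat n)" for n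
      using newton_forward[of f 0 n] by (simp add: mahler_of_nat a_def f_def mult.commute)
  qed
  with a show thesis by (rule that)
qed

section \<open>The transform\<close>

lemma vabs_transform_term_le:
  fixes s :: 'a
  assumes "s \<in> Zp"
  shows "vabs (fact n * (s gchoose n)) \<le> decay n"
proof -
  have "vabs (fact n * (s gchoose n)) \<le> vabs (fact n :: 'a)"
    using vabs_mult_le_left[OF vabs_gbinomial_le_1[OF assms]] by (simp add: mult.commute)
  then show ?thesis using vabs_fact_le_decay order_trans by blast
qed

lemma transform_of_nat:
  fixes \<psi> :: "'a \<Rightarrow> 'a"
  shows "transform \<psi> (of_nat N) = (\<Sum>n\<le>N. (fact n * \<psi> (- 1 - of_nat n)) * of_nat (N choose n))"
proof -
  have "transform \<psi> (of_nat N) = (\<Sum>n. (fact n * \<psi> (- 1 - of_nat n)) * of_nat (N choose n))"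
    by (simp add: transform_def of_nat_in_Zp binomial_gbinomial)
  also have "\<dots> = (\<Sum>n\<le>N. (fact n * \<psi> (- 1 - of_nat n)) * of_nat (N choose n))"
    by (intro suminf_finite) (auto simp: binomial_eq_0)
  finally show ?thesis .
qed

text \<open>
  At a natural number \<open>N\<close> the series of the transform stops at \<open>n = N\<close>. So the values at the
  natural numbers determine all \<open>n! * \<psi>(- 1 - n)\<close>, and the points \<open>- 1 - n\<close> are dense.
\<close>

lemma inj_on_transform: "inj_on transform (continuous_Zp :: ('a \<Rightarrow> 'a) set)"
proof (rule inj_onI)
  fix \<psi> \<phi> :: "'a \<Rightarrow> 'a"
  assume \<psi>: "\<psi> \<in> continuous_Zp" and \<phi>: "\<phi> \<in> continuous_Zp" and eq: "transform \<psi> = transform \<phi>"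
  have "(\<lambda>n. fact n * \<psi> (- 1 - of_nat n)) = (\<lambda>n. fact n * \<phi> (- 1 - of_nat n))"
    by (rule binomial_transform_inj) (simp only: eq flip: transform_of_nat)
  then have neg: "\<psi> (- 1 - of_nat n) = \<phi> (- 1 - of_nat n)" for n
    by (auto dest: fun_cong[where x = n])
  show "\<psi> = \<phi>"
    by (rule continuous_Zp_eqI[OF \<psi> \<phi> neg_succ_in_Zp Zp_approx_neg_succ neg])
qed

lemma inj_on_mahler: "inj_on mahler {a. a \<longlonglongrightarrow> 0}"
  by (rule inj_onI, rule binomial_transform_inj) (simp flip: mahler_of_nat)

text \<open>
  Around \<open>x0\<close> the \<open>n\<close>-th term of the transform is \<open>\<psi>(- 1 - n)\<close> times the falling
  polynomial at \<open>x0\<close>, evaluated at \<open>h = x - x0\<close>. On the disc of radius \<open>1 / p\<close> the Gauss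
  norms of these polynomials tend to zero, which permits collecting the powers of \<open>h\<close>. The
  radius is the same for all \<open>x0\<close>.
\<close>

lemma transform_locally_analytic:
  fixes \<psi> :: "'a \<Rightarrow> 'a"
  assumes "\<psi> \<in> continuous_Zp"
  shows "transform \<psi> \<in> locally_analytic_Zp"
proof -
  let ?r = "1 / real p"
  obtain M where M: "\<And>x. x \<in> Zp \<Longrightarrow> vabs (\<psi> x) \<le> M"
    using continuous_Zp_bounded[OF assms] by metis
  have M0: "0 \<le> M" using M[OF neg_succ_in_Zp[of 0]] vabs_nonneg order_trans by blast
  define w where "w n = \<psi> (- 1 - of_nat n)" for n
  have w: "vabs (w n) \<le> M" for n using M[OF neg_succ_in_Zp] by (simp add: w_def)
  have Md: "(\<lambda>n. M * decay n) \<longlonglongrightarrow> 0"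
    using tendsto_mult[OF tendsto_const decay_tendsto_0, of M] by simp
  have "\<exists>c. \<forall>x\<in>Zp. dist x x0 < ?r \<longrightarrow> (\<lambda>i. c i * (x - x0) ^ i) sums transform \<psi> x"
    if x0: "x0 \<in> Zp" for x0 :: 'a
  proof -
    let ?P = "falling_poly x0"
    define c where "c i = (\<Sum>n. w n * coeff (?P n) i)" for i
    have P: "vabs (coeff (?P n) i) * ?r ^ i \<le> decay n" for n i
      using falling_poly_decay[OF x0] by (simp add: gauss_le_def)
    have "(\<lambda>i. c i * (x - x0) ^ i) sums transform \<psi> x" if x: "x \<in> Zp" "dist x x0 < ?r" for x
    proof -
      define h where "h = x - x0"
      have h: "vabs h \<le> ?r" using x by (simp add: h_def dist_vabs)
      define F where "F n i = w n * coeff (?P n) i * h ^ i" for n i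
      have F_le: "vabs (F n i) \<le> M * decay n" for n i
      proof -
        have "vabs (F n i) = vabs (w n) * (vabs (coeff (?P n) i) * vabs h ^ i)"
          by (simp add: F_def vabs_mult vabs_power)
        also have "vabs (coeff (?P n) i) * vabs h ^ i \<le> vabs (coeff (?P n) i) * ?r ^ i"
          using h by (intro mult_left_mono power_mono) auto
        also have "\<dots> \<le> decay n" by (rule P)
        finally show ?thesis
          using w M0 decay_bounds by (meson mult_mono order_trans mult_left_mono vabs_nonneg less_imp_le mult_right_mono)
      qed
      have deg: "F n i = 0" if "n < i" for n i
      proof -
        have "degree (?P n) \<le> n"
          unfolding falling_poly_def by (rule order_trans[OF degree_prod_sum_le]) auto
        then show ?thesis using that by (simp add: F_def coeff_eq_0)
      qed
      have small: "\<exists>N. \<forall>n i. N \<le> n \<or> N \<le> i \<longrightarrow> vabs (F n i) \<le> e" if e: "0 < e" for e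
      proof -
        obtain N where N: "\<And>n. N \<le> n \<Longrightarrow> M * decay n < e"
          using order_tendstoD(2)[OF Md e] by (auto simp: eventually_sequentially)
        have "vabs (F n i) \<le> e" if "N \<le> n \<or> N \<le> i" for n i
        proof (cases "N \<le> n")
          case True
          then show ?thesis using F_le[of n i] N[of n] by linarith
        next
          case False
          then show ?thesis using that deg e by simp
        qed
        then show ?thesis by blast
      qed
      have row: "(\<Sum>i. F n i) = fact n * w n * (x gchoose n)" for n
      proof -
        have "(\<Sum>i. F n i) = (\<Sum>i\<le>degree (?P n). F n i)"
          by (intro suminf_finite) (auto simp: F_def coeff_eq_0)
        also have "\<dots> = w n * poly (?P n) h"
          by (simp add: F_def poly_altdef sum_distrib_left mult.assoc)
        finally show ?thesis by (simp add: poly_falling_poly h_def mult_ac)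
      qed
      have col: "(\<Sum>n. F n i) = c i * h ^ i" for i
      proof -
        have r: "0 < ?r ^ i" using inverse_p_bounds by simp
        have "(\<lambda>n. w n * coeff (?P n) i) \<longlonglongrightarrow> 0"
        proof (rule tendsto_vabs_bound)
          have "vabs (w n * coeff (?P n) i) \<le> M * decay n / ?r ^ i" for n
          proof -
            have "vabs (w n) * (vabs (coeff (?P n) i) * ?r ^ i) \<le> M * decay n"
              using w P M0 r by (intro mult_mono) auto
            then show ?thesis using r by (simp add: vabs_mult pos_le_divide_eq mult.assoc)
          qed
          then show "\<forall>\<^sub>F n in sequentially. vabs (w n * coeff (?P n) i - 0) \<le> M * decay n / ?r ^ i"
            by simp
          show "(\<lambda>n. M * decay n / ?r ^ i) \<longlonglongrightarrow> 0"
            by (rule tendsto_divide_zero[OF Md])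
        qed
        then have "(\<lambda>n. w n * coeff (?P n) i) sums c i"
          unfolding c_def by (intro summable_sums summable_ultrametric)
        from sums_mult_left[OF this, of "h ^ i"]
        have "(\<lambda>n. F n i) sums (c i * h ^ i)" by (simp add: F_def mult_ac)
        then show ?thesis by (simp add: sums_iff)
      qed
      have "(\<lambda>i. \<Sum>n. F n i) sums (\<Sum>n. \<Sum>i. F n i)"
        by (rule sums_swap_ultrametric) (rule small)
      moreover have "(\<Sum>n. \<Sum>i. F n i) = transform \<psi> x"
        using x by (simp add: row transform_def w_def)
      ultimately show ?thesis by (simp add: col h_def)
    qed
    then show ?thesis by blast
  qed
  then have "\<forall>x0\<in>Zp. \<exists>r>0. \<exists>c. \<forall>x\<in>Zp. dist x x0 < r \<longrightarrow> (\<lambda>n. c n * (x - x0) ^ n) sums transform \<psi> x"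
    using inverse_p_bounds(1) by blast
  moreover have "transform \<psi> \<in> extensional Zp" by (simp add: transform_def)
  ultimately show ?thesis by (simp add: locally_analytic_Zp_def)
qed

section \<open>The transform of a Mahler series\<close>

text \<open>
  The difference operator lowers the index of a binomial coefficient by one, so it shifts the
  coefficients of a Mahler series; those of \<^const>\<open>q\<close> are the factorials.
\<close>

lemma nabla_funpow_q:
  fixes s :: 'a
  assumes "s \<in> Zp"
  shows "(nabla ^^ k) q s = (\<Sum>n. fact (n + k) * (s gchoose n))"
  using assms
proof (induction k arbitrary: s)
  case 0
  then show ?case by (simp add: q_def)
next
  case (Suc k)
  have conv: "summable (\<lambda>n. fact (n + l) * (x gchoose n))" if x: "x \<in> Zp" for x :: 'a and l
  proof (rule summable_ultrametric, rule tendsto_vabs_bound[OF _ decay_tendsto_0], rule always_eventually, rule allI)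
    fix n
    have "vabs ((x gchoose n) * fact (n + l)) \<le> vabs (fact (n + l) :: 'a)"
      by (rule vabs_mult_le_left[OF vabs_gbinomial_le_1[OF x]])
    also have "\<dots> \<le> decay (n + l)" by (rule vabs_fact_le_decay)
    also have "\<dots> \<le> decay n" by (rule decay_antimono) simp
    finally show "vabs (fact (n + l) * (x gchoose n) - 0) \<le> decay n" by (simp add: mult.commute)
  qed
  define b c where "b n = fact (n + k) * (s gchoose n)" and "c n = fact (n + Suc k) * (s gchoose n)" for n
  have b: "b sums suminf b" and c: "c sums suminf c"
    using conv[OF Suc.prems] by (auto simp: b_def[abs_def] c_def[abs_def] intro!: summable_sums simp del: add_Suc_right)
  \<comment> \<open>By Pascal's rule the series at \<open>s + 1\<close> is the one at \<open>s\<close> plus \<open>c\<close> shifted by one.\<close>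
  have "(\<lambda>n. case n of 0 \<Rightarrow> 0 | Suc m \<Rightarrow> c m) sums (suminf c + 0)"
    using sums_Suc[of "\<lambda>n. case n of 0 \<Rightarrow> 0 | Suc m \<Rightarrow> c m"] c by simp
  from sums_add[OF b this]
  have "(\<lambda>n. b n + (case n of 0 \<Rightarrow> 0 | Suc m \<Rightarrow> c m)) sums (suminf b + suminf c)" by simp
  also have "(\<lambda>n. b n + (case n of 0 \<Rightarrow> 0 | Suc m \<Rightarrow> c m)) = (\<lambda>n. fact (n + k) * (s + 1 gchoose n))"
  proof
    fix n show "b n + (case n of 0 \<Rightarrow> 0 | Suc m \<Rightarrow> c m) = fact (n + k) * (s + 1 gchoose n)"
      by (cases n; simp add: b_def c_def gbinomial_Suc_Suc; simp add: algebra_simps)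
  qed
  finally have "(\<Sum>n. fact (n + k) * (s + 1 gchoose n)) = suminf b + suminf c"
    by (simp add: sums_iff)
  then have "(nabla ^^ k) q (s + 1) - (nabla ^^ k) q s = suminf c"
    using Suc Zp_add_1 by (simp add: b_def[abs_def])
  moreover have "(nabla ^^ Suc k) q s = (nabla ^^ k) q (s + 1) - (nabla ^^ k) q s"
    using Suc.prems by (simp add: nabla_def[of "(nabla ^^ k) q"])
  ultimately show ?case
    by (simp add: c_def[abs_def])
qed

text \<open>
  Dividing by \<open>k!\<close> turns \<open>(n + k)!\<close> into \<open>n!\<close> times an integer. This is why the
  functions \<open>nabla^k q / k!\<close> are bounded by one.
\<close>

lemma q_term_eq:
  fixes s :: 'a
  assumes "s \<in> Zp"
  shows "q_term a k s = (\<Sum>n. a k * (- 1) ^ k * (fact n * of_nat (n + k choose k) * (s gchoose n)))"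
    and "vabs (q_term a k s) \<le> vabs (a k)"
proof -
  let ?u = "\<lambda>n. fact n * of_nat (n + k choose k) * (s gchoose n)"
  have u_le: "vabs (?u n) \<le> decay n" for n
    using vabs_mult_le_left[OF vabs_of_nat_le_1[of "n + k choose k"], of "fact n * (s gchoose n)"]
      vabs_transform_term_le[OF assms, of n] by (simp add: mult_ac)
  have u0: "?u \<longlonglongrightarrow> 0"
    by (rule tendsto_vabs_bound[OF _ decay_tendsto_0]) (simp add: u_le)
  have "fact (n + k) * (s gchoose n) = fact k * ?u n" for n
  proof -
    have "of_nat (n + k choose k) = (fact (n + k) / (fact k * fact n) :: 'a)"
      using binomial_fact[of k "n + k", where 'a = 'a] by simp
    then show ?thesis by simp
  qed
  then have "(nabla ^^ k) q s = (\<Sum>n. fact k * ?u n)"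
    by (simp only: nabla_funpow_q[OF assms])
  also have "\<dots> = fact k * suminf ?u"
    by (rule sums_unique[symmetric], rule sums_mult_left, rule summable_sums, rule summable_ultrametric, rule u0)
  finally have "(nabla ^^ k) q s = fact k * suminf ?u" .
  then have eq: "q_term a k s = a k * (- 1) ^ k * suminf ?u"
    by (simp add: q_term_def)
  show "q_term a k s = (\<Sum>n. a k * (- 1) ^ k * ?u n)"
    unfolding eq
    by (rule sums_unique, rule sums_mult_left, rule summable_sums, rule summable_ultrametric, rule u0)
  have "vabs (?u n) \<le> 1" for n using u_le[of n] decay_bounds(2)[of n] by linarith
  then have "vabs (suminf ?u) \<le> 1"
    using suminf_tail_le[OF u0, of 0 1] by simp
  then have "vabs (suminf ?u * (a k * (- 1) ^ k)) \<le> vabs (a k * (- 1) ^ k)"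
    by (rule vabs_mult_le_left)
  then show "vabs (q_term a k s) \<le> vabs (a k)"
    by (simp add: eq vabs_mult vabs_power mult.commute)
qed

lemma uniform_limit_q_series:
  fixes a :: "nat \<Rightarrow> 'a"
  assumes "a \<longlonglongrightarrow> 0"
  shows "uniform_limit Zp (\<lambda>N s. \<Sum>n<N. q_term a n s) (q_series a) sequentially"
proof -
  have "uniform_limit Zp (\<lambda>N s. \<Sum>n<N. q_term a n s) (\<lambda>s. \<Sum>n. q_term a n s) sequentially"
    by (rule uniform_limit_ultrametric_series[where b = "\<lambda>n. vabs (a n)"])
      (use assms q_term_eq(2) in \<open>auto simp flip: tendsto_0_vabs_iff\<close>)
  then show ?thesis
    by (rule uniform_limit_cong'[THEN iffD1, rotated -1]) (auto simp: q_series_def)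
qed

text \<open>
  Negating the upper argument makes the binomial coefficients at \<open>- 1 - n\<close> integers, the same
  ones, with the same signs, that occur in \<open>q_term_eq\<close>.
\<close>

lemma mahler_neg_succ:
  "mahler a (- 1 - of_nat n) = (\<Sum>k. a k * (- 1) ^ k * of_nat (n + k choose k))"
proof -
  have "(- 1 - of_nat n :: 'a) gchoose k = (- 1) ^ k * of_nat (n + k choose k)" for k
    using gbinomial_minus[of "1 + of_nat n :: 'a" k] by (simp add: binomial_gbinomial algebra_simps)
  then show ?thesis by (simp add: mahler_def neg_succ_in_Zp mult.assoc)
qed

text \<open>
  By the two preceding formulas, both sides are iterated sums of the array
  \<open>a k * (- 1) ^ k * n! * binomial(n + k, k) * binomial(s, n)\<close>, in opposite orders. The entries are
  small for large \<open>k\<close> because of \<open>a\<close> and for large \<open>n\<close> because of the factorial.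
\<close>

theorem transform_mahler:
  fixes a :: "nat \<Rightarrow> 'a"
  assumes a: "a \<longlonglongrightarrow> 0"
  shows "transform (mahler a) = q_series a"
proof (rule extensionalityI)
  show "transform (mahler a) \<in> extensional Zp" "q_series a \<in> extensional Zp"
    by (auto simp: transform_def q_series_def)
  fix s :: 'a assume s: "s \<in> Zp"
  have va: "(\<lambda>k. vabs (a k)) \<longlonglongrightarrow> 0" using a by (simp flip: tendsto_0_vabs_iff)
  then have "Bseq (\<lambda>k. vabs (a k))" by (intro convergent_imp_Bseq convergentI)
  then obtain M where M: "0 < M" "\<And>k. vabs (a k) \<le> M" by (auto simp: Bseq_def)
  have Md: "(\<lambda>n. M * decay n) \<longlonglongrightarrow> 0"
    using tendsto_mult[OF tendsto_const decay_tendsto_0, of M] by simp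
  define F where "F k n = a k * (- 1) ^ k * (fact n * of_nat (n + k choose k) * (s gchoose n))" for k n
  have F_le: "vabs (F k n) \<le> vabs (a k) * decay n" for k n
  proof -
    have "vabs (F k n) = vabs (a k) * (vabs (of_nat (n + k choose k) :: 'a) * vabs (fact n * (s gchoose n)))"
      by (simp add: F_def vabs_mult vabs_power)
    also have "\<dots> \<le> vabs (a k) * (1 * decay n)"
      using s by (intro mult_left_mono mult_mono vabs_of_nat_le_1 vabs_transform_term_le) auto
    finally show ?thesis by simp
  qed
  have small: "\<exists>N. \<forall>k n. N \<le> k \<or> N \<le> n \<longrightarrow> vabs (F k n) \<le> e" if e: "0 < e" for e
  proof -
    obtain N1 where N1: "\<And>n. N1 \<le> n \<Longrightarrow> M * decay n < e"
      using order_tendstoD(2)[OF Md e] by (auto simp: eventually_sequentially)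
    obtain N2 where N2: "\<And>k. N2 \<le> k \<Longrightarrow> vabs (a k) < e"
      using order_tendstoD(2)[OF va e] by (auto simp: eventually_sequentially)
    have "vabs (F k n) \<le> e" if "max N1 N2 \<le> k \<or> max N1 N2 \<le> n" for k n
    proof -
      have "vabs (a k) * decay n \<le> M * decay n" "vabs (a k) * decay n \<le> vabs (a k)"
        using M decay_bounds[of n] by (auto intro: mult_right_mono mult_left_le)
      then show ?thesis using that F_le[of k n] N1[of n] N2[of k] by force
    qed
    then show ?thesis by blast
  qed
  have col: "(\<Sum>k. F k n) = fact n * mahler a (- 1 - of_nat n) * (s gchoose n)" for n
  proof -
    let ?v = "\<lambda>k. a k * (- 1) ^ k * of_nat (n + k choose k)"
    have "?v \<longlonglongrightarrow> 0"
    proof (rule tendsto_vabs_bound[OF _ va], rule always_eventually, rule allI)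
      show "vabs (?v k - 0) \<le> vabs (a k)" for k
        using vabs_of_nat_le_1[of "n + k choose k"] by (simp add: vabs_mult vabs_power mult_left_le)
    qed
    then have "?v sums mahler a (- 1 - of_nat n)"
      unfolding mahler_neg_succ by (intro summable_sums summable_ultrametric)
    from sums_mult_left[OF this, of "fact n * (s gchoose n)"] show ?thesis
      by (simp add: sums_iff F_def mult_ac)
  qed
  have "(\<lambda>n. \<Sum>k. F k n) sums (\<Sum>k. \<Sum>n. F k n)"
    by (rule sums_swap_ultrametric) (rule small)
  then show "transform (mahler a) s = q_series a s"
    using s by (simp add: transform_def q_series_def q_term_eq(1) col flip: F_def) (simp add: sums_iff)
qed

end

theorem corollary6p16:
  fixes p :: nat
  assumes "prime p"
    and "is_Cp p TYPE('a::{nonarch_valued_field, complete_space})"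
  shows "(transform :: ('a \<Rightarrow> 'a) \<Rightarrow> 'a \<Rightarrow> 'a) \<in> continuous_Zp \<rightarrow> locally_analytic_Zp \<and>
    (\<forall>a :: nat \<Rightarrow> 'a. a \<longlonglongrightarrow> 0 \<longrightarrow>
       uniform_limit Zp (\<lambda>N s. \<Sum>n<N. q_term a n s) (q_series a) sequentially) \<and>
    transform ` continuous_Zp = {\<Psi> :: 'a \<Rightarrow> 'a. \<exists>a. a \<longlonglongrightarrow> 0 \<and> \<Psi> = q_series a} \<and>
    (\<forall>\<Psi> \<in> transform ` (continuous_Zp :: ('a \<Rightarrow> 'a) set).
       \<exists>!a. a \<longlonglongrightarrow> 0 \<and> \<Psi> = q_series a)"
proof -
  interpret padic_complete_field p "TYPE('a)"
  proof
    show "prime p" by (rule assms)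
    show "vabs (of_int k :: 'a) = (1 / real p) ^ multiplicity (int p) k" if "k \<noteq> 0" for k
      using assms(2) that unfolding is_Cp_def by blast
  qed
  have image: "transform ` continuous_Zp = {\<Psi> :: 'a \<Rightarrow> 'a. \<exists>a. a \<longlonglongrightarrow> 0 \<and> \<Psi> = q_series a}"
  proof (intro subset_antisym subsetI)
    fix \<Psi> :: "'a \<Rightarrow> 'a" assume "\<Psi> \<in> transform ` continuous_Zp"
    then obtain \<psi> where "\<psi> \<in> continuous_Zp" and \<Psi>: "\<Psi> = transform \<psi>" by blast
    from mahler_expansion[OF this(1)] obtain a where a: "a \<longlonglongrightarrow> 0" "\<psi> = mahler a" .
    then have "\<Psi> = q_series a" using \<Psi> transform_mahler by simp
    with a show "\<Psi> \<in> {\<Psi>. \<exists>a. a \<longlonglongrightarrow> 0 \<and> \<Psi> = q_series a}" by blast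
  next
    fix \<Psi> :: "'a \<Rightarrow> 'a" assume "\<Psi> \<in> {\<Psi>. \<exists>a. a \<longlonglongrightarrow> 0 \<and> \<Psi> = q_series a}"
    then obtain a where a: "a \<longlonglongrightarrow> 0" "\<Psi> = q_series a" by blast
    then have "\<Psi> = transform (mahler a)" by (simp add: transform_mahler)
    then show "\<Psi> \<in> transform ` continuous_Zp"
      using mahler_continuous[OF a(1)] by (rule image_eqI)
  qed
  have unique: "a = b" if a: "a \<longlonglongrightarrow> 0" and b: "b \<longlonglongrightarrow> 0" and eq: "q_series a = q_series b"
    for a b :: "nat \<Rightarrow> 'a"
  proof -
    have "transform (mahler a) = transform (mahler b)"
      using eq a b by (simp add: transform_mahler)
    then have "mahler a = mahler b"
      by (rule inj_onD[OF inj_on_transform]) (intro mahler_continuous a b)+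
    then show ?thesis by (rule inj_onD[OF inj_on_mahler]) (use a b in simp_all)
  qed
  show ?thesis
  proof (intro conjI ballI)
    show "(transform :: ('a \<Rightarrow> 'a) \<Rightarrow> 'a \<Rightarrow> 'a) \<in> continuous_Zp \<rightarrow> locally_analytic_Zp"
      using transform_locally_analytic by blast
    show "\<forall>a :: nat \<Rightarrow> 'a. a \<longlonglongrightarrow> 0 \<longrightarrow>
        uniform_limit Zp (\<lambda>N s. \<Sum>n<N. q_term a n s) (q_series a) sequentially"
      using uniform_limit_q_series by blast
    fix \<Psi> :: "'a \<Rightarrow> 'a" assume "\<Psi> \<in> transform ` continuous_Zp"
    then obtain a where "a \<longlonglongrightarrow> 0" "\<Psi> = q_series a" unfolding image by blast
    then show "\<exists>!a. a \<longlonglongrightarrow> 0 \<and> \<Psi> = q_series a"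
      using unique by blast
  qed (rule image)
qed

end
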